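(* Let $z_1=\dfrac{x_1^2+x_2^2+1}{x_1x_2}\in\mathbb{Q}(x_1,x_2)$ and, for $n\ge1$, let $z_n=P_n(z_1)$, where $P_n$ is the $n$-th normalized Chebyshev polynomial of the first kind. Then for every $n\ge1$, $$z_{n} = x_1^{-n} x_2^{-n} \left(x_1^{2n} + x_2^{2n} + \sum_{q+r \leq n-1} \frac{n}{n-q-r} \binom{n-1-r}{q}\binom{n-1-q}{r} x_1^{2q} x_2^{2r}\right),$$ where the sum runs over pairs of nonnegative integers $(q,r)$ with $q+r\le n-1$.
   Context: $x_1,x_2$ are independent variables. The normalized Chebyshev polynomials of the second kind $S_n$ are defined by $S_{-1}(x)=0$, $S_0(x)=1$, $S_{n+1}(x)=xS_n(x)-S_{n-1}(x)$ for $n\ge0$, with the convention $S_{-2}(x)=0$. The normalized Chebyshev polynomials of the first kind are $P_n(x)=S_n(x)-S_{n-2}(x)$ for $n\ge0$. (The elements $z_n$, $n\ge 1$, together with the cluster monomials, form the canonical basis of the cluster algebra associated with the Kronecker quiver.) *)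

theory Defs
  imports
    "HOL-Computational_Algebra.Polynomial"
    "HOL-Computational_Algebra.Fraction_Field"
begin

(* Normalized Chebyshev polynomials of the second kind. The index is an integer so that the
   conventions S_{-2} = S_{-1} = 0 can be stated literally; indices below -2 carry the value 0
   only because the function must be total. *)
function chebyshev_S :: "int \<Rightarrow> int poly" where
  "chebyshev_S n =
     (if n < 0 then 0
      else if n = 0 then 1
      else [:0, 1:] * chebyshev_S (n - 1) - chebyshev_S (n - 2))"
  by pat_completeness auto
termination
  by (relation "measure (\<lambda>n. nat (n + 1))") auto

declare chebyshev_S.simps [simp del]

lemma chebyshev_S_minus_2: "chebyshev_S (- 2) = 0"
  by (simp add: chebyshev_S.simps)

lemma chebyshev_S_minus_1: "chebyshev_S (- 1) = 0"
  by (simp add: chebyshev_S.simps)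

lemma chebyshev_S_0: "chebyshev_S 0 = 1"
  by (simp add: chebyshev_S.simps)

lemma chebyshev_S_rec:
  "n \<ge> 0 \<Longrightarrow> chebyshev_S (n + 1) = [:0, 1:] * chebyshev_S n - chebyshev_S (n - 1)"
  by (subst chebyshev_S.simps) simp

definition chebyshev_P :: "nat \<Rightarrow> int poly" where
  "chebyshev_P n = chebyshev_S (int n) - chebyshev_S (int n - 2)"

(* The field Q(x1, x2), as the fraction field of Q[x1][x2]. *)
type_synonym ratfun2 = "rat poly poly fract"

definition x1 :: ratfun2 where
  "x1 = Fract [:[:0, 1:]:] 1"

definition x2 :: ratfun2 where
  "x2 = Fract [:0, 1:] 1"

definition kronecker_z1 :: ratfun2 where
  "kronecker_z1 = (x1 ^ 2 + x2 ^ 2 + 1) / (x1 * x2)"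

(* Evaluates P_n at z_1 after mapping its integer coefficients into Q(x1, x2). Only n \<ge> 1 is
   meant; the clash of names at n = 1 is harmless by the lemma below. *)
definition kronecker_z :: "nat \<Rightarrow> ratfun2" where
  "kronecker_z n = poly (map_poly of_int (chebyshev_P n)) kronecker_z1"

lemma kronecker_z_1: "kronecker_z 1 = kronecker_z1"
proof -
  have "chebyshev_S 1 = [:0, 1:]"
    using chebyshev_S_rec[of 0] by (simp add: chebyshev_S_0 chebyshev_S_minus_1)
  then show ?thesis
    by (simp add: kronecker_z_def chebyshev_P_def chebyshev_S_minus_1 map_poly_pCons)
qed

end

theory Submission
  imports Defs "HOL-Computational_Algebra.Formal_Power_Series"
begin

text \<open>
  Put \<open>a = x1^2\<close>, \<open>b = x2^2\<close>. The Chebyshev recurrence says that \<open>(x1 x2)^n z_n\<close> is the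
  \<open>n\<close>-th power sum of the two reciprocal roots of
  \<open>E(X) = 1 - (a + b + 1) X + a b X^2\<close>, that is, the coefficient of \<open>X^n\<close> in the series
  \<open>- X E'(X) / E(X)\<close> (Newton's identities). The point is the factorisation
  \<open>E(X) = (1 - a X) (1 - b X) - X = (1 - a X) (1 - b X) (1 - u)\<close> with
  \<open>u = X / ((1 - a X) (1 - b X))\<close>.
  The logarithmic derivative turns the product into a sum. The first two factors contribute
  \<open>a^n + b^n\<close>. For the third, \<open>- log (1 - u)\<close> is the sum of \<open>u^m / m\<close> over \<open>m \<ge> 1\<close>, and
  \<open>X d/dX\<close> multiplies the coefficient of \<open>X^n\<close> by \<open>n\<close>, so it contributes the
  coefficients of \<open>X^n\<close> in \<open>(n/m) u^m\<close>, for \<open>1 \<le> m \<le> n\<close>.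
  Expanding \<open>u^m = X^m (1 - a X)^(-m) (1 - b X)^(-m)\<close> by the negative binomial series yields the
  terms \<open>(n/m) binom(m+q-1, q) binom(m+r-1, r) a^q b^r\<close> with \<open>m + q + r = n\<close>: this is the
  double sum, where \<open>m = n - q - r\<close> is the denominator.
\<close>

unbundle fps_syntax

section \<open>Power sums from logarithmic derivatives\<close>

text \<open>
  If \<open>f\<close> is the product of factors \<open>1 - c X\<close>, the coefficient of \<open>X^n\<close> for \<open>n \<ge> 1\<close> is the sum
  of the powers \<open>c^n\<close>. The \<open>X\<close> and the sign in the definition are there to make this true
  without a shift.
\<close>

definition power_sums :: "'a::field fps \<Rightarrow> 'a fps" where
  "power_sums f = - (fps_X * fps_deriv f * inverse f)"

lemma power_sums_times_self:
  assumes "f $ 0 \<noteq> 0"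
  shows "power_sums f * f = - (fps_X * fps_deriv f)"
  using inverse_mult_eq_1[OF assms] by (simp add: power_sums_def mult.assoc)

lemma power_sums_mult:
  assumes "f $ 0 \<noteq> 0" "g $ 0 \<noteq> 0"
  shows "power_sums (f * g) = power_sums f + power_sums g"
proof -
  have nz: "f * g \<noteq> 0"
    using assms by auto
  have "power_sums (f * g) * (f * g) = - (fps_X * (f * fps_deriv g + fps_deriv f * g))"
    using assms by (subst power_sums_times_self) auto
  also have "\<dots> = - (fps_X * fps_deriv f) * g + - (fps_X * fps_deriv g) * f"
    by (simp add: algebra_simps)
  also have "\<dots> = (power_sums f * f) * g + (power_sums g * g) * f"
    by (simp only: power_sums_times_self[OF assms(1)] power_sums_times_self[OF assms(2)])
  also have "\<dots> = (power_sums f + power_sums g) * (f * g)"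
    by (simp add: algebra_simps)
  finally show ?thesis
    using nz by simp
qed

text \<open>
  This is \<open>X d/dX\<close> of \<open>- log (1 - u) = u + u^2/2 + u^3/3 + \<dots>\<close>. Truncating the series at
  \<open>m = n\<close> is harmless for the coefficient of \<open>X^n\<close>, because \<open>u^n\<close> is divisible by \<open>X^n\<close>
  and \<open>power_sums\<close> supplies another factor \<open>X\<close>.
\<close>

lemma power_sums_one_minus_nth:
  fixes u :: "'a::field_char_0 fps"
  assumes "u $ 0 = 0"
  shows "power_sums (1 - u) $ n = (\<Sum>m=1..n. of_nat n / of_nat m * (u ^ m) $ n)"
proof -
  let ?L = "power_sums (1 - u)"
  have L: "?L * (1 - u) = fps_X * fps_deriv u"
    using assms by (subst power_sums_times_self) auto
  have "?L - ?L * u ^ n = ?L * (1 - u ^ n)"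
    by (simp add: algebra_simps)
  also have "\<dots> = ?L * ((1 - u) * (\<Sum>m<n. u ^ m))"
    by (simp only: one_diff_power_eq)
  also have "\<dots> = (\<Sum>m<n. fps_X * fps_deriv u * u ^ m)"
    by (simp only: mult.assoc[symmetric] L sum_distrib_left)
  also have "\<dots> = (\<Sum>m=1..n. fps_X * fps_deriv u * u ^ (m - 1))"
    by (rule sum.reindex_bij_witness[of _ "\<lambda>m. m - 1" Suc]) auto
  finally have expand: "?L = (\<Sum>m=1..n. fps_X * fps_deriv u * u ^ (m - 1)) + ?L * u ^ n"
    by (simp add: algebra_simps)
  have "(?L * u ^ n) $ n = ?L $ 0 * (u ^ n) $ n"
    using assms
    by (cases n) (auto simp: fps_mult_nth startsby_zero_power_prefix sum.atLeast_Suc_atMost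
        intro!: sum.neutral)
  also have "?L $ 0 = 0"
    by (simp add: power_sums_def)
  finally have tail: "(?L * u ^ n) $ n = 0"
    by simp
  have "(fps_X * fps_deriv u * u ^ (m - 1)) $ n = of_nat n / of_nat m * (u ^ m) $ n"
    if "m \<in> {1..n}" for m
  proof -
    have "of_nat n * (u ^ m) $ n = (fps_X * fps_deriv (u ^ m)) $ n"
      by (cases n) auto
    also have "fps_deriv (u ^ m) = fps_const (of_nat m) * (fps_deriv u * u ^ (m - 1))"
      by (simp add: fps_deriv_power mult.assoc)
    also have "fps_X * \<dots> = fps_const (of_nat m) * (fps_X * fps_deriv u * u ^ (m - 1))"
      by (simp add: algebra_simps)
    also have "\<dots> $ n = of_nat m * (fps_X * fps_deriv u * u ^ (m - 1)) $ n"
      by (rule fps_mult_left_const_nth)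
    finally have "of_nat n * (u ^ m) $ n = of_nat m * (fps_X * fps_deriv u * u ^ (m - 1)) $ n" .
    then show ?thesis
      using that by (simp add: field_simps del: fps_X_mult_nth)
  qed
  then show ?thesis
    by (subst expand) (simp add: tail fps_sum_nth)
qed

lemma power_sums_linear_nth:
  fixes c :: "'a::field_char_0"
  assumes "n \<ge> 1"
  shows "power_sums (1 - fps_const c * fps_X) $ n = c ^ n"
proof -
  have "power_sums (1 - fps_const c * fps_X) $ n =
      (\<Sum>m=1..n. of_nat n / of_nat m * (if m = n then c ^ m else 0))"
    by (subst power_sums_one_minus_nth)
      (auto simp: power_mult_distrib fps_const_power intro!: sum.cong)
  also have "\<dots> = (\<Sum>m=1..n. if m = n then c ^ n else 0)"
    by (rule sum.cong) auto
  finally show ?thesis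
    using assms by simp
qed

section \<open>Chebyshev polynomials as power sums\<close>

text \<open>
  The recurrence fails at \<open>n = 1\<close>, where it would need the usual value \<open>P_0 = 2\<close>: the convention
  \<open>S_{-2} = 0\<close> gives \<open>P_0 = 1\<close>. So \<open>P_1\<close> and \<open>P_2\<close> are the initial values.
\<close>

lemma chebyshev_P_1: "chebyshev_P 1 = [:0, 1:]"
  and chebyshev_P_2: "chebyshev_P 2 = [:- 2, 0, 1:]"
  and chebyshev_P_rec:
    "n \<ge> 2 \<Longrightarrow> chebyshev_P (Suc n) = [:0, 1:] * chebyshev_P n - chebyshev_P (n - 1)"
proof -
  have S1: "chebyshev_S 1 = [:0, 1:]"
    using chebyshev_S_rec[of 0] by (simp add: chebyshev_S_0 chebyshev_S_minus_1)
  have S2: "chebyshev_S 2 = [:0, 1:] * [:0, 1:] - 1"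
    using chebyshev_S_rec[of 1] by (simp add: S1 chebyshev_S_0)
  show "chebyshev_P 1 = [:0, 1:]"
    by (simp add: chebyshev_P_def S1 chebyshev_S_minus_1)
  show "chebyshev_P 2 = [:- 2, 0, 1:]"
    by (simp add: chebyshev_P_def S2 chebyshev_S_0 one_pCons)
  show "chebyshev_P (Suc n) = [:0, 1:] * chebyshev_P n - chebyshev_P (n - 1)" if "n \<ge> 2"
  proof -
    have S: "chebyshev_S (int n + 1) = [:0, 1:] * chebyshev_S (int n) - chebyshev_S (int n - 1)"
      using chebyshev_S_rec[of "int n"] by simp
    have S': "chebyshev_S (int n - 1) =
        [:0, 1:] * chebyshev_S (int n - 2) - chebyshev_S (int n - 3)"
      using chebyshev_S_rec[of "int n - 2"] that by simp
    have "chebyshev_P (Suc n) = chebyshev_S (int n + 1) - chebyshev_S (int n - 1)"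
      by (simp add: chebyshev_P_def algebra_simps)
    also have "\<dots> = [:0, 1:] * (chebyshev_S (int n) - chebyshev_S (int n - 2)) -
        (chebyshev_S (int n - 1) - chebyshev_S (int n - 3))"
      by (subst S, subst (2) S') (simp only: algebra_simps)
    finally show ?thesis
      using that by (simp add: chebyshev_P_def of_nat_diff)
  qed
qed

text \<open>
  For \<open>n \<ge> 1\<close> and \<open>z = v + 1/v\<close> the polynomial \<open>P_n\<close> takes the value \<open>v^n + v^(-n)\<close>. After scaling by \<open>t^n\<close>,
  this is the power sum of \<open>t v\<close> and \<open>t/v\<close>, the reciprocal roots of the quadratic series.
\<close>

lemma poly_chebyshev_P_eq_power_sums:
  fixes z t :: "'a::field_char_0"
  assumes "n \<ge> 1"
  shows "t ^ n * poly (map_poly of_int (chebyshev_P n)) z =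
    power_sums (1 - fps_const (t * z) * fps_X + fps_const (t ^ 2) * fps_X ^ 2) $ n"
    (is "_ = power_sums ?E $ n")
proof -
  define L where "L = power_sums ?E"
  let ?p = "\<lambda>n. poly (map_poly of_int (chebyshev_P n)) z"
  have p1: "?p 1 = z"
    by (simp add: chebyshev_P_1 map_poly_pCons del: One_nat_def)
  have p2: "?p 2 = z ^ 2 - 2"
    by (simp add: chebyshev_P_2 map_poly_pCons power2_eq_square)
  have p_rec: "?p (Suc n) = z * ?p n - ?p (n - 1)" if "n \<ge> 2" for n
  proof -
    have diff: "map_poly of_int (p - q) = map_poly of_int p - (map_poly of_int q :: 'a poly)"
      for p q :: "int poly"
      by (rule poly_eqI) (simp add: coeff_map_poly)
    show ?thesis
      using that by (simp add: chebyshev_P_rec diff map_poly_pCons)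
  qed
  have "L * ?E = - (fps_X * fps_deriv ?E)"
    unfolding L_def by (rule power_sums_times_self) simp
  also have "\<dots> = fps_const (t * z) * fps_X - fps_const (2 * t ^ 2) * fps_X ^ 2"
    by (simp add: fps_deriv_power power2_eq_square fps_numeral_fps_const algebra_simps
        flip: fps_const_mult fps_const_add)
  finally have "L = fps_const (t * z) * fps_X - fps_const (2 * t ^ 2) * fps_X ^ 2
      + fps_const (t * z) * (fps_X * L) - fps_const (t ^ 2) * (fps_X ^ 2 * L)"
    by (simp add: algebra_simps)
  then have L_nth: "L $ m = (fps_const (t * z) * fps_X - fps_const (2 * t ^ 2) * fps_X ^ 2
      + fps_const (t * z) * (fps_X * L) - fps_const (t ^ 2) * (fps_X ^ 2 * L)) $ m" for m
    by (rule arg_cong)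
  have L0: "L $ 0 = 0"
    by (simp add: L_def power_sums_def)
  have L1: "L $ 1 = t * z"
    using L_nth[of 1] by (simp add: L0 fps_X_power_mult_nth)
  have L2: "L $ 2 = (t * z) * L $ 1 - 2 * t ^ 2"
    using L_nth[of 2] by (simp add: L0 fps_X_power_mult_nth)
  have L_rec: "L $ Suc n = (t * z) * L $ n - t ^ 2 * L $ (n - 1)" if "n \<ge> 2" for n
    using L_nth[of "Suc n"] that by (simp add: fps_X_power_mult_nth)
  from assms have "t ^ n * ?p n = L $ n"
  proof (induction n rule: less_induct)
    case (less n)
    consider "n = 1" | "n = 2" | k where "n = Suc (Suc (Suc k))"
      using less.prems by (metis One_nat_def Suc_le_D numeral_2_eq_2 old.nat.exhaust)
    then show ?case
    proof cases
      case 1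
      then show ?thesis
        by (simp add: p1 L1 del: One_nat_def)
    next
      case 2
      then show ?thesis
        by (simp add: p2 L2 L1 power2_eq_square algebra_simps del: One_nat_def)
    next
      case 3
      have "t ^ n * ?p n =
          t * z * (t ^ Suc (Suc k) * ?p (Suc (Suc k))) - t ^ 2 * (t ^ Suc k * ?p (Suc k))"
        by (simp add: 3 p_rec power2_eq_square algebra_simps)
      also have "\<dots> = t * z * L $ Suc (Suc k) - t ^ 2 * L $ Suc k"
        using less.IH[of "Suc (Suc k)"] less.IH[of "Suc k"] 3 by simp
      also have "\<dots> = L $ n"
        using L_rec[of "Suc (Suc k)"] by (simp add: 3)
      finally show ?thesis .
    qed
  qed
  then show ?thesis
    by (simp only: L_def)
qed

section \<open>Power sums of the quadratic series with trace a + b + 1\<close>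

lemma inverse_linear_product_power_nth:
  fixes a b :: "'a::field_char_0"
  assumes "m \<ge> 1"
  shows "(inverse ((1 - fps_const a * fps_X) * (1 - fps_const b * fps_X)) ^ m) $ k =
    (\<Sum>q=0..k. of_nat ((m + q - 1) choose q) * a ^ q *
      (of_nat ((m + (k - q) - 1) choose (k - q)) * b ^ (k - q)))"
proof -
  have "inverse ((1 - fps_const a * fps_X) * (1 - fps_const b * fps_X)) ^ m =
      inverse ((1 - fps_const a * fps_X) ^ m) * inverse ((1 - fps_const b * fps_X) ^ m)"
    by (simp add: fps_inverse_mult fps_inverse_power power_mult_distrib)
  then show ?thesis
    using assms by (simp add: one_minus_const_fps_X_neg_power' fps_mult_nth)
qed

text \<open>
  The splitting off of \<open>X\<close> from \<open>(1 - a X) (1 - b X)\<close> is what makes the answer a double sum with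
  positive coefficients: the summand \<open>X\<close> accounts for the \<open>1\<close> in the trace \<open>a + b + 1\<close>, and dividing by
  the product turns it into the perturbation \<open>u\<close> of \<open>1\<close>.
\<close>

lemma power_sums_kronecker_nth:
  fixes a b :: "'a::field_char_0"
  assumes "n \<ge> 1"
  shows "power_sums (1 - fps_const (a + b + 1) * fps_X + fps_const (a * b) * fps_X ^ 2) $ n =
    a ^ n + b ^ n +
    (\<Sum>(q, r) \<in> {(q, r). q + r \<le> n - 1}.
      of_nat n / of_nat (n - q - r) *
      of_nat ((n - 1 - r) choose q) * of_nat ((n - 1 - q) choose r) * a ^ q * b ^ r)"
    (is "power_sums ?E $ n = _ + _ + ?T")
proof -
  let ?A = "1 - fps_const a * fps_X" and ?B = "1 - fps_const b * fps_X"
  define D where "D = ?A * ?B"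
  define u where "u = fps_X * inverse D"
  have D0: "D $ 0 = 1"
    by (simp add: D_def)
  have u0: "u $ 0 = 0"
    by (simp add: u_def)
  have "D * (1 - u) = D - fps_X * (inverse D * D)"
    by (simp add: u_def algebra_simps)
  also have "inverse D * D = 1"
    by (rule inverse_mult_eq_1) (simp add: D0)
  also have "D - fps_X * 1 = ?E"
    by (simp add: D_def algebra_simps power2_eq_square flip: fps_const_add fps_const_mult)
  finally have "power_sums ?E = power_sums (D * (1 - u))"
    by (rule arg_cong[OF sym])
  also have "\<dots> = power_sums D + power_sums (1 - u)"
    by (rule power_sums_mult) (simp_all add: D0 u0)
  also have "power_sums D = power_sums ?A + power_sums ?B"
    unfolding D_def by (rule power_sums_mult) simp_all
  finally have "power_sums ?E = power_sums ?A + power_sums ?B + power_sums (1 - u)" .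
  then have "power_sums ?E $ n = a ^ n + b ^ n + power_sums (1 - u) $ n"
    using assms by (simp add: power_sums_linear_nth)
  also have "power_sums (1 - u) $ n = (\<Sum>m=1..n. of_nat n / of_nat m * (u ^ m) $ n)"
    by (rule power_sums_one_minus_nth[OF u0])
  also have "\<dots> = (\<Sum>m=1..n. \<Sum>q=0..n-m. of_nat n / of_nat m *
      (of_nat ((m + q - 1) choose q) * a ^ q *
      (of_nat ((m + (n - m - q) - 1) choose (n - m - q)) * b ^ (n - m - q))))"
    by (rule sum.cong)
      (auto simp: u_def D_def power_mult_distrib fps_X_power_mult_nth sum_distrib_left
        inverse_linear_product_power_nth simp del: fps_inverse_mult)
  also have "\<dots> = (\<Sum>(m, q)\<in>(SIGMA m:{1..n}. {0..n-m}). of_nat n / of_nat m *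
      (of_nat ((m + q - 1) choose q) * a ^ q *
      (of_nat ((m + (n - m - q) - 1) choose (n - m - q)) * b ^ (n - m - q))))"
    by (rule sum.Sigma) auto
  \<comment> \<open>The exponents are \<open>q\<close> and \<open>r = n - m - q\<close>; the condition \<open>m \<ge> 1\<close> becomes \<open>q + r \<le> n - 1\<close>.\<close>
  also have "\<dots> = ?T"
    using assms
    by (intro sum.reindex_bij_witness[of _ "\<lambda>(q, r). (n - q - r, q)" "\<lambda>(m, q). (q, n - m - q)"])
      (auto simp: algebra_simps)
  finally show ?thesis .
qed

section \<open>The closed formula over the rational function field\<close>

instance fract :: ("{idom, ring_char_0}") field_char_0
  by standard (auto simp: inj_on_def of_nat_fract eq_fract)

theorem theorem5p4:
  fixes n :: nat
  assumes "n \<ge> 1"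
  shows "kronecker_z n =
    x1 powi (- int n) * x2 powi (- int n) *
    (x1 ^ (2 * n) + x2 ^ (2 * n) +
     (\<Sum>(q, r) \<in> {(q, r). q + r \<le> n - 1}.
        of_nat n / of_nat (n - q - r) *
        of_nat ((n - 1 - r) choose q) * of_nat ((n - 1 - q) choose r) *
        x1 ^ (2 * q) * x2 ^ (2 * r)))"
    (is "_ = _ * ?W")
proof -
  have nz: "x1 \<noteq> 0" "x2 \<noteq> 0"
    by (simp_all add: x1_def x2_def Zero_fract_def eq_fract)
  have tz: "x1 * x2 * kronecker_z1 = x1 ^ 2 + x2 ^ 2 + 1"
    using nz by (simp add: kronecker_z1_def)
  have "(x1 * x2) ^ n * kronecker_z n = power_sums (1 - fps_const (x1 ^ 2 + x2 ^ 2 + 1) * fps_X +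
      fps_const (x1 ^ 2 * x2 ^ 2) * fps_X ^ 2) $ n"
    using poly_chebyshev_P_eq_power_sums[OF assms, of "x1 * x2" kronecker_z1]
    by (simp only: kronecker_z_def tz power_mult_distrib)
  also have "\<dots> = ?W"
    by (simp only: power_sums_kronecker_nth[OF assms] power_mult)
  finally have "x1 ^ n * x2 ^ n * kronecker_z n = ?W"
    by (simp only: power_mult_distrib)
  moreover have "kronecker_z n =
      inverse (x1 ^ n) * inverse (x2 ^ n) * (x1 ^ n * x2 ^ n * kronecker_z n)"
    using nz by (simp add: field_simps)
  ultimately have "kronecker_z n = inverse (x1 ^ n) * inverse (x2 ^ n) * ?W"
    by simp
  then show ?thesis
    by (simp add: power_int_minus)
qed

end
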